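(* Let $(\Omega^\bullet,d)$ be a differential calculus on an algebra $A$, and let $V$ be a vector space of derivations on $A$, closed under commutator, for which the interior products and Lie derivatives are well defined. For all $\theta,\phi\in V$, all $n\ge 0$ and all $\omega\in\Omega^n$, $${\cal L}_\theta{\cal L}_\phi(\omega)-{\cal L}_\phi{\cal L}_\theta(\omega)={\cal L}_{[\theta,\phi]}(\omega).$$
   Context: $A$ is an associative unital (not necessarily commutative) algebra over a field. A differential calculus on $A$ is a collection of $A$-bimodules $\Omega^n$, $n\ge 0$, with $\Omega^0=A$, with an associative graded product $\Omega^n\times\Omega^m\to\Omega^{n+m}$ extending the bimodule structure, and with a linear signed derivation $d:\Omega^n\to\Omega^{n+1}$, i.e. $d(\omega\tau)=d(\omega)\,\tau+(-1)^{|\omega|}\omega\,d(\tau)$ (where $|\omega|=n$ if $\omega\in\Omega^n$), such that $d^2=0$ and $\Omega^{n+1}$ is spanned by the elements $\omega\,db$ with $\omega\in\Omega^n$, $b\in A$. Everything is purely algebraic (no topology). $V$ is a vector space of linear maps $\theta:A\to A$ with $\theta(ab)=\theta(a)b+a\theta(b)$, closed under the commutator $[\theta,\phi]=\theta\phi-\phi\theta$. Interior product: for $\theta\in V$, $\theta\lrcorner:\Omega^{n+1}\to\Omega^n$ is the linear map determined by $\theta\lrcorner a=0$ for $a\in\Omega^0=A$, $\theta\lrcorner da=\theta(a)$, and $\theta\lrcorner(\omega\tau)=(\theta\lrcorner\,\omega)\tau+(-1)^{|\omega|}\omega(\theta\lrcorner\tau)$. Lie derivative: for $\theta\in V$, ${\cal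 L}_\theta:\Omega^n\to\Omega^n$ is the linear map determined by ${\cal L}_\theta(a)=\theta(a)$ for $a\in\Omega^0=A$, ${\cal L}_\theta(da)=d(\theta(a))$, and ${\cal L}_\theta(\omega\tau)={\cal L}_\theta(\omega)\tau+\omega{\cal L}_\theta(\tau)$. Standing assumption: for every $\theta\in V$ the maps $\theta\lrcorner$ and ${\cal L}_\theta$ are well defined on all of $\Omega^\bullet$ (i.e. compatible with all relations in the calculus). *)

theory Defs
  imports Complex_Main
begin

text \<open>
  The sort \<open>{ring, monoid_mult}\<close> is used instead of \<open>ring_1\<close> because the latter
  assumes \<open>0 \<noteq> 1\<close>, which would exclude the zero algebra.
\<close>

locale unital_algebra = vector_space scale
  for scale :: "'k::field \<Rightarrow> 'a::{ring, monoid_mult} \<Rightarrow> 'a" +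
  assumes scale_mult_left: "scale c (x * y) = scale c x * y"
    and scale_mult_right: "scale c (x * y) = x * scale c y"

text \<open>
  The collection \<open>\<Omega>\<^sup>n\<close> is presented as the homogeneous components \<open>\<Omega> n\<close> of its direct sum
  \<open>\<Omega>\<^sup>\<bullet>\<close>, which is the type \<open>'w\<close>; the products \<open>\<Omega>\<^sup>m \<times> \<Omega>\<^sup>n \<rightarrow> \<Omega>\<^sup>m\<^sup>+\<^sup>n\<close> together form
  the multiplication of \<open>'w\<close>. The identification \<open>\<Omega>\<^sup>0 = A\<close> is the algebra isomorphism \<open>\<iota>\<close>,
  and the bimodule actions on \<open>\<Omega> n\<close> are \<open>\<iota> a * \<omega>\<close> and \<open>\<omega> * \<iota> a\<close>.
\<close>

locale differential_calculus =
  A: unital_algebra sA + Om: unital_algebra sO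
  for sA :: "'k::field \<Rightarrow> 'a::{ring, monoid_mult} \<Rightarrow> 'a"
    and sO :: "'k \<Rightarrow> 'w::{ring, monoid_mult} \<Rightarrow> 'w" +
  fixes \<Omega> :: "nat \<Rightarrow> 'w set"
    and \<iota> :: "'a \<Rightarrow> 'w"
    and d :: "'w \<Rightarrow> 'w"
  assumes subspace_component: "Om.subspace (\<Omega> n)"
    and direct_sum:
      "\<exists>!c. (\<forall>n. c n \<in> \<Omega> n) \<and> finite {n. c n \<noteq> 0} \<and> w = (\<Sum>n | c n \<noteq> 0. c n)"
    and mult_component: "\<lbrakk>\<omega> \<in> \<Omega> m; \<tau> \<in> \<Omega> n\<rbrakk> \<Longrightarrow> \<omega> * \<tau> \<in> \<Omega> (m + n)"
    and linear_iota: "Vector_Spaces.linear sA sO \<iota>"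
    and iota_mult: "\<iota> (a * b) = \<iota> a * \<iota> b"
    and iota_one: "\<iota> 1 = 1"
    and bij_iota: "bij_betw \<iota> UNIV (\<Omega> 0)"
    and linear_d: "Vector_Spaces.linear sO sO d"
    and d_component: "\<omega> \<in> \<Omega> n \<Longrightarrow> d \<omega> \<in> \<Omega> (Suc n)"
    and d_mult: "\<lbrakk>\<omega> \<in> \<Omega> m; \<tau> \<in> \<Omega> n\<rbrakk> \<Longrightarrow> d (\<omega> * \<tau>) = d \<omega> * \<tau> + (- 1) ^ m * (\<omega> * d \<tau>)"
    and d_d: "\<omega> \<in> \<Omega> n \<Longrightarrow> d (d \<omega>) = 0"
    and spanning: "\<Omega> (Suc n) = Om.span {\<omega> * d (\<iota> b) | \<omega> b. \<omega> \<in> \<Omega> n}"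
begin

definition is_interior_product :: "('a \<Rightarrow> 'a) \<Rightarrow> ('w \<Rightarrow> 'w) \<Rightarrow> bool" where
  "is_interior_product \<theta> i \<longleftrightarrow>
     Vector_Spaces.linear sO sO i \<and>
     (\<forall>n. \<forall>\<omega>\<in>\<Omega> (Suc n). i \<omega> \<in> \<Omega> n) \<and>
     (\<forall>a. i (\<iota> a) = 0) \<and>
     (\<forall>a. i (d (\<iota> a)) = \<iota> (\<theta> a)) \<and>
     (\<forall>m n. \<forall>\<omega>\<in>\<Omega> m. \<forall>\<tau>\<in>\<Omega> n. i (\<omega> * \<tau>) = i \<omega> * \<tau> + (- 1) ^ m * (\<omega> * i \<tau>))"

definition is_lie_derivative :: "('a \<Rightarrow> 'a) \<Rightarrow> ('w \<Rightarrow> 'w) \<Rightarrow> bool" where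
  "is_lie_derivative \<theta> L \<longleftrightarrow>
     Vector_Spaces.linear sO sO L \<and>
     (\<forall>n. \<forall>\<omega>\<in>\<Omega> n. L \<omega> \<in> \<Omega> n) \<and>
     (\<forall>a. L (\<iota> a) = \<iota> (\<theta> a)) \<and>
     (\<forall>a. L (d (\<iota> a)) = d (\<iota> (\<theta> a))) \<and>
     (\<forall>m n. \<forall>\<omega>\<in>\<Omega> m. \<forall>\<tau>\<in>\<Omega> n. L (\<omega> * \<tau>) = L \<omega> * \<tau> + \<omega> * L \<tau>)"

text \<open>
  Being well defined means existence of such a map: uniqueness is automatic by \<open>spanning\<close>
  (for Lie derivatives see \<open>is_lie_derivative_unique\<close> below).
\<close>

definition interior_product_well_defined :: "('a \<Rightarrow> 'a) \<Rightarrow> bool" where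
  "interior_product_well_defined \<theta> \<longleftrightarrow> (\<exists>i. is_interior_product \<theta> i)"

definition lie_derivative_well_defined :: "('a \<Rightarrow> 'a) \<Rightarrow> bool" where
  "lie_derivative_well_defined \<theta> \<longleftrightarrow> (\<exists>L. is_lie_derivative \<theta> L)"

definition lie_derivative :: "('a \<Rightarrow> 'a) \<Rightarrow> 'w \<Rightarrow> 'w" where
  "lie_derivative \<theta> = (THE L. is_lie_derivative \<theta> L)"

lemma is_lie_derivative_unique:
  assumes L: "is_lie_derivative \<theta> L" and M: "is_lie_derivative \<theta> M"
  shows "L = M"
proof -
  interpret L: Vector_Spaces.linear sO sO L
    using L by (simp add: is_lie_derivative_def)
  interpret M: Vector_Spaces.linear sO sO M
    using M by (simp add: is_lie_derivative_def)
  have component: "\<forall>\<omega>\<in>\<Omega> n. L \<omega> = M \<omega>" for n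
  proof (induction n)
    case 0
    show ?case
    proof
      fix \<omega> assume "\<omega> \<in> \<Omega> 0"
      then obtain a where "\<omega> = \<iota> a"
        using bij_iota by (auto simp: bij_betw_def)
      then show "L \<omega> = M \<omega>"
        using L M by (simp add: is_lie_derivative_def)
    qed
  next
    case (Suc n)
    show ?case
    proof
      fix \<omega> assume "\<omega> \<in> \<Omega> (Suc n)"
      then have "\<omega> \<in> Om.span {\<omega> * d (\<iota> b) | \<omega> b. \<omega> \<in> \<Omega> n}"
        using spanning by simp
      then show "L \<omega> = M \<omega>"
      proof (induction rule: Om.span_induct_alt)
        case base
        show ?case by (simp add: L.zero M.zero)
      next
        case (step c x y)
        then obtain \<tau> b where x: "x = \<tau> * d (\<iota> b)" "\<tau> \<in> \<Omega> n" by blast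
        have b: "d (\<iota> b) \<in> \<Omega> (Suc 0)"
          using bij_iota by (intro d_component) (auto simp: bij_betw_def)
        have "L x = L \<tau> * d (\<iota> b) + \<tau> * d (\<iota> (\<theta> b))"
          using L x b by (auto simp: is_lie_derivative_def)
        moreover have "M x = M \<tau> * d (\<iota> b) + \<tau> * d (\<iota> (\<theta> b))"
          using M x b by (auto simp: is_lie_derivative_def)
        ultimately have "L x = M x"
          using Suc.IH x by simp
        then show ?case
          using step by (simp add: L.add M.add L.scale M.scale)
      qed
    qed
  qed
  show ?thesis
  proof
    fix w
    obtain c where c: "\<forall>n. c n \<in> \<Omega> n" and w: "w = (\<Sum>n | c n \<noteq> 0. c n)"
      using direct_sum[of w] by blast
    show "L w = M w"
      unfolding w L.sum M.sum using component c by (intro sum.cong) auto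
  qed
qed

end

definition commutator :: "('a::ab_group_add \<Rightarrow> 'a) \<Rightarrow> ('a \<Rightarrow> 'a) \<Rightarrow> 'a \<Rightarrow> 'a" where
  "commutator \<theta> \<phi> = (\<lambda>a. \<theta> (\<phi> a) - \<phi> (\<theta> a))"

locale derivation_space = unital_algebra sA
  for sA :: "'k::field \<Rightarrow> 'a::{ring, monoid_mult} \<Rightarrow> 'a" +
  fixes V :: "('a \<Rightarrow> 'a) set"
  assumes linear_derivation: "\<theta> \<in> V \<Longrightarrow> Vector_Spaces.linear sA sA \<theta>"
    and derivation_mult: "\<theta> \<in> V \<Longrightarrow> \<theta> (a * b) = \<theta> a * b + a * \<theta> b"
    and zero_closed: "(\<lambda>a. 0) \<in> V"
    and add_closed: "\<lbrakk>\<theta> \<in> V; \<phi> \<in> V\<rbrakk> \<Longrightarrow> (\<lambda>a. \<theta> a + \<phi> a) \<in> V"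
    and scale_closed: "\<theta> \<in> V \<Longrightarrow> (\<lambda>a. sA c (\<theta> a)) \<in> V"
    and commutator_closed: "\<lbrakk>\<theta> \<in> V; \<phi> \<in> V\<rbrakk> \<Longrightarrow> commutator \<theta> \<phi> \<in> V"

end

theory Submission
  imports Defs
begin

text \<open>
  The operator commutator of two degree-preserving derivations extending \<open>\<theta>\<close> and \<open>\<phi>\<close> and
  compatible with \<open>d\<close> on \<open>A\<close> is again such a map and extends \<open>[\<theta>, \<phi>]\<close>; since \<open>A\<close> and
  \<open>dA\<close> generate the calculus, it is the Lie derivative along \<open>[\<theta>, \<phi>]\<close>.
\<close>

context differential_calculus
begin

text \<open>Well-definedness only asserts existence; together with uniqueness it makes the definite
  description denote.\<close>

lemma is_lie_derivative_lie_derivative: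
  assumes "lie_derivative_well_defined \<theta>"
  shows "is_lie_derivative \<theta> (lie_derivative \<theta>)"
  using assms unfolding lie_derivative_well_defined_def lie_derivative_def
  by (metis theI is_lie_derivative_unique)

lemma lie_derivative_eqI:
  assumes "is_lie_derivative \<theta> L"
  shows "lie_derivative \<theta> = L"
  unfolding lie_derivative_def
  using assms by (blast intro: the_equality is_lie_derivative_unique)

text \<open>Each clause survives because \<open>L\<close> and \<open>M\<close> preserve degree and
  can be applied twice. \<open>commutator\<close> is used on operators of both algebras.\<close>

lemma is_lie_derivative_commutator:
  assumes L: "is_lie_derivative \<theta> L" and M: "is_lie_derivative \<phi> M"
  shows "is_lie_derivative (commutator \<theta> \<phi>) (commutator L M)"
proof -
  interpret L: Vector_Spaces.linear sO sO L
    using L by (simp add: is_lie_derivative_def)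
  interpret M: Vector_Spaces.linear sO sO M
    using M by (simp add: is_lie_derivative_def)
  interpret d: Vector_Spaces.linear sO sO d
    by (rule linear_d)
  interpret \<iota>: Vector_Spaces.linear sA sO \<iota>
    by (rule linear_iota)
  have linear: "Vector_Spaces.linear sO sO (commutator L M)"
    by unfold_locales
      (simp_all add: commutator_def L.add M.add L.scale M.scale Om.scale_right_diff_distrib)
  have component: "commutator L M \<omega> \<in> \<Omega> n" if "\<omega> \<in> \<Omega> n" for \<omega> n
    using that L M subspace_component
    by (simp add: commutator_def is_lie_derivative_def Om.subspace_diff)
  have iota: "commutator L M (\<iota> a) = \<iota> (commutator \<theta> \<phi> a)" for a
    using L M by (simp add: commutator_def is_lie_derivative_def \<iota>.diff)
  \<comment> \<open>Both operators keep the form \<open>d (\<iota> _)\<close>, so their clauses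
    apply twice; linearity of \<open>\<iota>\<close> and \<open>d\<close> collects the
    difference.\<close>
  have d_iota: "commutator L M (d (\<iota> a)) = d (\<iota> (commutator \<theta> \<phi> a))" for a
    using L M by (simp add: commutator_def is_lie_derivative_def \<iota>.diff d.diff)
  have mult: "commutator L M (\<omega> * \<tau>) = commutator L M \<omega> * \<tau> + \<omega> * commutator L M \<tau>"
    if \<omega>: "\<omega> \<in> \<Omega> m" and \<tau>: "\<tau> \<in> \<Omega> n" for \<omega> \<tau> m n
  proof -
    \<comment> \<open>The degrees are fixed here because, in the general clause, they occur only in
      the premises, where rewriting cannot instantiate them.\<close>
    have L_mult: "L (x * y) = L x * y + x * L y" if "x \<in> \<Omega> m" "y \<in> \<Omega> n" for x y
      using L that by (auto simp: is_lie_derivative_def)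
    have M_mult: "M (x * y) = M x * y + x * M y" if "x \<in> \<Omega> m" "y \<in> \<Omega> n" for x y
      using M that by (auto simp: is_lie_derivative_def)
    have "L \<omega> \<in> \<Omega> m" "L \<tau> \<in> \<Omega> n" "M \<omega> \<in> \<Omega> m" "M \<tau> \<in> \<Omega> n"
      using L M \<omega> \<tau> by (auto simp: is_lie_derivative_def)
    with \<omega> \<tau> show ?thesis
      \<comment> \<open>The cross terms \<open>L \<omega> * M \<tau>\<close> and
        \<open>M \<omega> * L \<tau>\<close> arise from both compositions and cancel; no factors are
        swapped.\<close>
      by (simp add: commutator_def L_mult M_mult L.add M.add algebra_simps)
  qed
  show ?thesis
    using linear component iota d_iota mult by (auto simp: is_lie_derivative_def)
qed

end

theorem proposition2p9:
  fixes sA :: "'k::field \<Rightarrow> 'a::{ring, monoid_mult} \<Rightarrow> 'a"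
    and sO :: "'k \<Rightarrow> 'w::{ring, monoid_mult} \<Rightarrow> 'w"
    and \<Omega> :: "nat \<Rightarrow> 'w set"
    and \<iota> :: "'a \<Rightarrow> 'w"
    and d :: "'w \<Rightarrow> 'w"
    and V :: "('a \<Rightarrow> 'a) set"
    and \<theta> \<phi> :: "'a \<Rightarrow> 'a"
    and n :: nat
    and \<omega> :: 'w
  assumes "differential_calculus sA sO \<Omega> \<iota> d"
    and "derivation_space sA V"
    and "\<forall>\<psi>\<in>V. differential_calculus.interior_product_well_defined sO \<Omega> \<iota> d \<psi>"
    and "\<forall>\<psi>\<in>V. differential_calculus.lie_derivative_well_defined sO \<Omega> \<iota> d \<psi>"
    and "\<theta> \<in> V" and "\<phi> \<in> V"
    and "\<omega> \<in> \<Omega> n"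
  shows "differential_calculus.lie_derivative sO \<Omega> \<iota> d \<theta>
           (differential_calculus.lie_derivative sO \<Omega> \<iota> d \<phi> \<omega>)
       - differential_calculus.lie_derivative sO \<Omega> \<iota> d \<phi>
           (differential_calculus.lie_derivative sO \<Omega> \<iota> d \<theta> \<omega>)
       = differential_calculus.lie_derivative sO \<Omega> \<iota> d (commutator \<theta> \<phi>) \<omega>"
proof -
  interpret differential_calculus sA sO \<Omega> \<iota> d
    by fact
  have "is_lie_derivative \<theta> (lie_derivative \<theta>)" "is_lie_derivative \<phi> (lie_derivative \<phi>)"
    using assms by (auto intro: is_lie_derivative_lie_derivative)
  \<comment> \<open>The claim is proved as an equality of operators, with the operator commutator as
    the witness for \<open>[\<theta>, \<phi>]\<close>.\<close>
  then have "lie_derivative (commutator \<theta> \<phi>) = commutator (lie_derivative \<theta>) (lie_derivative \<phi>)"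
    by (intro lie_derivative_eqI is_lie_derivative_commutator)
  then show ?thesis
    by (simp add: commutator_def)
qed

end
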